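(* Let $A$ be an alphabet and $\eta:A^*\to A^*$ a substitution with growing letter $a\in A$. Let $u=u_0u_1u_2\cdots\in A^{\mathbb{Z}_{\ge0}}$ be a right-infinite periodic point of $\eta$ with $u_0=a$, and let $p\geq1$ be a period of $u$. For every integer $n\geq1$ there exist a unique integer $k=k(n)$ such that $p$ divides $k$ and a unique sequence $(m_i,a_i)_{i=0,\dots,k-1}$ such that (i) this sequence is $a$-admissible and $m_{k-1}m_{k-2}\cdots m_{k-p}\neq\varepsilon$; (ii) $u_0u_1\cdots u_{n-1}=\eta^{k-1}(m_{k-1})\eta^{k-2}(m_{k-2})\cdots\eta^0(m_0)$.
   Context: An alphabet $A$ is a finite set; $A^*$ is the set of finite words, $\varepsilon$ the empty word, $|w|$ the length. A substitution is a morphism $\eta:A^*\to A^*$ such that $\eta(a)$ is nonempty for every $a\in A$ and some letter is growing; a letter $a$ is growing if $|\eta^k(a)|\to\infty$ as $k\to\infty$. $\eta$ acts on right-infinite words by $\eta(u_0u_1u_2\cdots)=\eta(u_0)\eta(u_1)\eta(u_2)\cdots$; $u$ is a periodic point if $\eta^p(u)=u$ for some $p\ge1$, and any such $p$ is called a period of $u$. A sequence $(m_i,a_i)_{i=0,\dots,k}$ in $A^*\times A$ is $x$-admissible if $m_{i-1}a_{i-1}$ is a prefix of $\eta(a_i)$ for all $1\le i\le k$ and $m_ka_k$ is a prefix of $\eta(x)$. *)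

theory Defs
  imports Complex_Main "HOL-Library.Stream" "HOL-Library.Sublist"
begin

definition word_morphism :: "('a list \<Rightarrow> 'a list) \<Rightarrow> bool" where
  "word_morphism \<eta> \<longleftrightarrow> \<eta> [] = [] \<and> (\<forall>v w. \<eta> (v @ w) = \<eta> v @ \<eta> w)"

definition growing :: "('a list \<Rightarrow> 'a list) \<Rightarrow> 'a \<Rightarrow> bool" where
  "growing \<eta> a \<longleftrightarrow> filterlim (\<lambda>k. length ((\<eta> ^^ k) [a])) at_top sequentially"

definition substitution :: "('a list \<Rightarrow> 'a list) \<Rightarrow> bool" where
  "substitution \<eta> \<longleftrightarrow>
     word_morphism \<eta> \<and> (\<forall>a. \<eta> [a] \<noteq> []) \<and> (\<exists>a. growing \<eta> a)"

text \<open>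
  The action on right-infinite words. Note that \<^const>\<open>flat\<close> is concatenation only for
  streams of nonempty words, which is the case here whenever \<open>\<eta>\<close> is a substitution.
\<close>
definition stream_action :: "('a list \<Rightarrow> 'a list) \<Rightarrow> 'a stream \<Rightarrow> 'a stream" where
  "stream_action \<eta> u = flat (smap (\<lambda>x. \<eta> [x]) u)"

definition is_period :: "('a list \<Rightarrow> 'a list) \<Rightarrow> 'a stream \<Rightarrow> nat \<Rightarrow> bool" where
  "is_period \<eta> u p \<longleftrightarrow> p \<ge> 1 \<and> (stream_action \<eta> ^^ p) u = u"

definition periodic_point :: "('a list \<Rightarrow> 'a list) \<Rightarrow> 'a stream \<Rightarrow> bool" where
  "periodic_point \<eta> u \<longleftrightarrow> (\<exists>p. is_period \<eta> u p)"

text \<open>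
  A sequence \<open>(m\<^sub>i, a\<^sub>i)\<close>, \<open>0 \<le> i \<le> k\<close>, is a list \<open>s\<close> of length \<open>k + 1\<close> (hence nonempty) with
  \<open>s ! i = (m\<^sub>i, a\<^sub>i)\<close>.
\<close>
definition admissible ::
    "('a list \<Rightarrow> 'a list) \<Rightarrow> 'a \<Rightarrow> ('a list \<times> 'a) list \<Rightarrow> bool" where
  "admissible \<eta> x s \<longleftrightarrow>
     s \<noteq> [] \<and>
     (\<forall>i. 1 \<le> i \<and> i < length s \<longrightarrow>
        prefix (fst (s ! (i - 1)) @ [snd (s ! (i - 1))]) (\<eta> [snd (s ! i)])) \<and>
     prefix (fst (last s) @ [snd (last s)]) (\<eta> [x])"

end

theory Submission
  imports Defs
begin

text \<open>
  Read from the top index down, an \<open>x\<close>-admissible sequence of length \<open>k\<close> is a path of successive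
  choices of a letter in \<open>\<eta>[x]\<close>, then in the image of that letter, and so on; it addresses one
  letter of \<open>\<eta>\<^sup>k[x]\<close>, and the word in (ii) is the part of \<open>\<eta>\<^sup>k[x]\<close> strictly before it. As \<open>\<eta>\<close> is
  nonerasing, for each \<open>k\<close> these paths correspond bijectively to the lengths \<open>n < |\<eta>\<^sup>k[x]|\<close>.
  Since \<open>\<eta>\<^sup>p[a]\<close> begins with \<open>a\<close>, the top \<open>p\<close> words \<open>m\<^sub>i\<close> are all empty exactly when the path
  stays in the initial factor \<open>\<eta>\<^bsup>k-p\<^esup>[a]\<close> of \<open>\<eta>\<^sup>k[a]\<close>. So the side condition in (i) says
  \<open>|\<eta>\<^bsup>k-p\<^esup>[a]| \<le> n\<close>, and as \<open>|\<eta>\<^bsup>pq\<^esup>[a]|\<close> is unbounded and nondecreasing in \<open>q\<close>, exactly one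
  multiple \<open>k\<close> of \<open>p\<close> satisfies \<open>|\<eta>\<^bsup>k-p\<^esup>[a]| \<le> n < |\<eta>\<^sup>k[a]|\<close>.
\<close>

text \<open>The paths below list the pairs \<open>(m\<^sub>i, a\<^sub>i)\<close> with the highest index first.\<close>

fun adm_path :: "('a list \<Rightarrow> 'a list) \<Rightarrow> 'a \<Rightarrow> ('a list \<times> 'a) list \<Rightarrow> bool" where
  "adm_path \<eta> x [] \<longleftrightarrow> True"
| "adm_path \<eta> x ((m, b) # t) \<longleftrightarrow> prefix (m @ [b]) (\<eta> [x]) \<and> adm_path \<eta> b t"

text \<open>With the highest index first, the index of a pair is the number of pairs after it; hence
  the exponent \<open>length t\<close>.\<close>

fun path_word :: "('a list \<Rightarrow> 'a list) \<Rightarrow> ('a list \<times> 'a) list \<Rightarrow> 'a list" where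
  "path_word \<eta> [] = []"
| "path_word \<eta> ((m, b) # t) = (\<eta> ^^ length t) m @ path_word \<eta> t"

fun path_end :: "'a \<Rightarrow> ('a list \<times> 'a) list \<Rightarrow> 'a" where
  "path_end x [] = x"
| "path_end x ((m, b) # t) = path_end b t"

lemma adm_path_append:
  "adm_path \<eta> x (s @ t) \<longleftrightarrow> adm_path \<eta> x s \<and> adm_path \<eta> (path_end x s) t"
  by (induction \<eta> x s rule: adm_path.induct) auto

section \<open>Translation of indexed sequences into paths\<close>

lemma admissible_snoc:
  "admissible \<eta> x (s @ [(m, b)]) \<longleftrightarrow>
     prefix (m @ [b]) (\<eta> [x]) \<and> (s = [] \<or> admissible \<eta> b s)"
proof (cases "s = []")
  case True
  then show ?thesis by (simp add: admissible_def)
next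
  case False
  have split: "(\<forall>i. 1 \<le> i \<and> i < Suc (length s) \<longrightarrow> P i) \<longleftrightarrow>
      (\<forall>i. 1 \<le> i \<and> i < length s \<longrightarrow> P i) \<and> P (length s)" for P
    using False by (auto simp: less_Suc_eq Suc_le_eq)
  have "(\<forall>i. 1 \<le> i \<and> i < length s \<longrightarrow>
        prefix (fst ((s @ [(m, b)]) ! (i - 1)) @ [snd ((s @ [(m, b)]) ! (i - 1))])
          (\<eta> [snd ((s @ [(m, b)]) ! i)])) \<longleftrightarrow>
      (\<forall>i. 1 \<le> i \<and> i < length s \<longrightarrow>
        prefix (fst (s ! (i - 1)) @ [snd (s ! (i - 1))]) (\<eta> [snd (s ! i)]))"
    by (auto simp: nth_append)
  with False show ?thesis
    unfolding admissible_def length_append_singleton split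
    by (auto simp: nth_append last_conv_nth)
qed

lemma admissible_iff_adm_path:
  "admissible \<eta> x s \<longleftrightarrow> s \<noteq> [] \<and> adm_path \<eta> x (rev s)"
proof (induction s arbitrary: x rule: rev_induct)
  case Nil
  then show ?case by (simp add: admissible_def)
next
  case (snoc c s)
  then show ?case by (cases c) (auto simp: admissible_snoc)
qed

lemma concat_powers_eq_path_word:
  "concat (map (\<lambda>i. (\<eta> ^^ i) (fst (s ! i))) (rev [0..<length s])) = path_word \<eta> (rev s)"
proof (induction s rule: rev_induct)
  case Nil
  then show ?case by simp
next
  case (snoc c s)
  have "map (\<lambda>i. (\<eta> ^^ i) (fst ((s @ [c]) ! i))) (rev [0..<length s]) =
      map (\<lambda>i. (\<eta> ^^ i) (fst (s ! i))) (rev [0..<length s])"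
    by (auto simp: nth_append)
  with snoc show ?case by (cases c) (simp del: map_eq_conv)
qed

text \<open>Moves the side condition in (i) to the first \<open>p\<close> steps of the path; the
  bound keeps \<open>length s - p\<close> from being truncated.\<close>

lemma concat_top_eq_take_rev:
  assumes "p \<le> length s"
  shows "concat (map (\<lambda>i. fst (s ! i)) (rev [length s - p..<length s])) =
    concat (map fst (take p (rev s)))"
proof -
  have "map (\<lambda>i. fst (s ! i)) (rev [length s - p..<length s]) = map fst (take p (rev s))"
    by (rule nth_equalityI) (use assms in \<open>auto simp: rev_nth\<close>)
  then show ?thesis by simp
qed

section \<open>Nonerasing morphisms and the positions addressed by paths\<close>

locale nonerasing_morphism =
  fixes \<eta> :: "'a list \<Rightarrow> 'a list"
  assumes morph_Nil: "\<eta> [] = []"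
    and morph_append: "\<eta> (v @ w) = \<eta> v @ \<eta> w"
    and morph_nonempty: "\<eta> [x] \<noteq> []"
begin

lemma funpow_Nil [simp]: "(\<eta> ^^ k) [] = []"
  by (induction k) (simp_all add: morph_Nil)

lemma funpow_append: "(\<eta> ^^ k) (v @ w) = (\<eta> ^^ k) v @ (\<eta> ^^ k) w"
  by (induction k) (simp_all add: morph_append)

lemma morph_eq_Nil_iff: "\<eta> w = [] \<longleftrightarrow> w = []"
proof (cases w)
  case (Cons x v)
  then show ?thesis using morph_append[of "[x]" v] morph_nonempty[of x] by simp
qed (simp add: morph_Nil)

lemma funpow_eq_Nil_iff [simp]: "(\<eta> ^^ k) w = [] \<longleftrightarrow> w = []"
  by (induction k) (simp_all add: morph_eq_Nil_iff)

lemma length_funpow_mono_prefix: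
  "prefix v w \<Longrightarrow> length ((\<eta> ^^ k) v) \<le> length ((\<eta> ^^ k) w)"
  by (auto simp: prefix_def funpow_append)

lemma path_word_append:
  "path_word \<eta> (s @ t) = (\<eta> ^^ length t) (path_word \<eta> s) @ path_word \<eta> t"
proof (induction s)
  case (Cons c s)
  then show ?case
    by (cases c) (simp add: funpow_append funpow_add add.commute[of "length s"])
qed simp

text \<open>Nonerasing powers cannot hide a nonempty \<open>m\<close>, so the side condition in (i),
  which carries no powers, can be tested on \<open>path_word\<close>.\<close>

lemma path_word_eq_Nil_iff: "path_word \<eta> t = [] \<longleftrightarrow> concat (map fst t) = []"
proof (induction t)
  case (Cons c t)
  then show ?case by (cases c) simp
qed simp

lemma prefix_path_word_end:
  "adm_path \<eta> x t \<Longrightarrow> prefix (path_word \<eta> t @ [path_end x t]) ((\<eta> ^^ length t) [x])"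
proof (induction t arbitrary: x)
  case (Cons c t)
  obtain m b where c: "c = (m, b)" by (cases c)
  with Cons.prems have "prefix (m @ [b]) (\<eta> [x])" and "adm_path \<eta> b t" by auto
  then obtain r where r: "\<eta> [x] = m @ [b] @ r" by (auto simp: prefix_def)
  from Cons.IH[OF \<open>adm_path \<eta> b t\<close>] show ?case
    by (simp add: c r funpow_swap1 funpow_append[of _ m] funpow_append[of _ "[b]" r, simplified])
qed simp

lemma length_path_word_less:
  "adm_path \<eta> x t \<Longrightarrow> length (path_word \<eta> t) < length ((\<eta> ^^ length t) [x])"
  using prefix_length_le[OF prefix_path_word_end[of x t]] by simp

lemma path_word_eq_take:
  assumes "adm_path \<eta> x t"
  shows "path_word \<eta> t = take (length (path_word \<eta> t)) ((\<eta> ^^ length t) [x])"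
  using prefix_path_word_end[OF assms] by (auto simp: prefix_def)

text \<open>A longer \<open>m'\<close> would contain \<open>m @ [b]\<close>, so its image would
  cover the whole image of \<open>b\<close>, whereas the word of the first path ends strictly before
  that image does. Used in both directions.\<close>

lemma adm_path_head_length_le:
  assumes "adm_path \<eta> x ((m, b) # s)" "adm_path \<eta> x ((m', b') # t)" "length s = length t"
    and "length (path_word \<eta> ((m, b) # s)) = length (path_word \<eta> ((m', b') # t))"
  shows "length m' \<le> length m"
proof (rule ccontr)
  assume "\<not> ?thesis"
  then have "length (m @ [b]) \<le> length m'" by simp
  moreover have "prefix (m @ [b]) (\<eta> [x])" "prefix m' (\<eta> [x])"
    using assms(1,2) append_prefixD by auto
  ultimately have "prefix (m @ [b]) m'" using prefix_length_prefix by blast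
  then have "length ((\<eta> ^^ length s) m) + length ((\<eta> ^^ length s) [b])
      \<le> length ((\<eta> ^^ length s) m')"
    using length_funpow_mono_prefix[of "m @ [b]" m' "length s"] by (simp add: funpow_append)
  with length_path_word_less[of b s] assms show False by simp
qed

lemma adm_path_unique:
  assumes "adm_path \<eta> x s" "adm_path \<eta> x t" "length s = length t"
    and "length (path_word \<eta> s) = length (path_word \<eta> t)"
  shows "s = t"
  using assms(3,1,2,4)
proof (induction s t arbitrary: x rule: list_induct2)
  case (Cons c s d t)
  obtain m b m' b' where cd: "c = (m, b)" "d = (m', b')" by (cases c, cases d)
  have "length m = length m'"
    using adm_path_head_length_le Cons.prems Cons.hyps unfolding cd by (metis le_antisym)
  moreover have "prefix (m @ [b]) (\<eta> [x])" "prefix (m' @ [b']) (\<eta> [x])"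
    using Cons.prems cd by auto
  ultimately have "m = m'" "b = b'" by (auto simp: prefix_def)
  then show ?case using Cons cd by auto
qed simp

text \<open>The images of the letters of \<open>w\<close> cut the positions of
  \<open>(\<eta> ^^ k) w\<close> into consecutive blocks; \<open>b\<close> is the letter whose block
  contains position \<open>n\<close>.\<close>

lemma funpow_locate_letter:
  assumes "n < length ((\<eta> ^^ k) w)"
  obtains m b where "prefix (m @ [b]) w" "length ((\<eta> ^^ k) m) \<le> n"
    "n < length ((\<eta> ^^ k) m) + length ((\<eta> ^^ k) [b])"
  using assms
proof (induction w arbitrary: thesis rule: rev_induct)
  case (snoc c w)
  show ?case
  proof (cases "n < length ((\<eta> ^^ k) w)")
    case True
    then show ?thesis using snoc.IH snoc.prems(1) by (metis prefix_prefix)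
  next
    case False
    then show ?thesis using snoc.prems by (intro snoc.prems(1)[of w c]) (auto simp: funpow_append)
  qed
qed simp

text \<open>Greedy expansion: locate the block containing \<open>n\<close>, subtract its offset, and
  continue inside the image of the chosen letter.\<close>

lemma adm_path_exists:
  "n < length ((\<eta> ^^ k) [x]) \<Longrightarrow>
    \<exists>t. adm_path \<eta> x t \<and> length t = k \<and> length (path_word \<eta> t) = n"
proof (induction k arbitrary: x n)
  case (Suc k)
  then have "n < length ((\<eta> ^^ k) (\<eta> [x]))" by (simp add: funpow_swap1)
  then obtain m b where mb: "prefix (m @ [b]) (\<eta> [x])" "length ((\<eta> ^^ k) m) \<le> n"
    "n < length ((\<eta> ^^ k) m) + length ((\<eta> ^^ k) [b])"
    by (rule funpow_locate_letter)
  then have "n - length ((\<eta> ^^ k) m) < length ((\<eta> ^^ k) [b])" by simp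
  with Suc.IH obtain t where "adm_path \<eta> b t" "length t = k"
    "length (path_word \<eta> t) = n - length ((\<eta> ^^ k) m)" by blast
  with mb show ?case by (intro exI[of _ "(m, b) # t"]) auto
qed simp

lemma top_nonempty_iff:
  assumes "prefix [a] ((\<eta> ^^ p) [a])" "adm_path \<eta> a t" "length t = p + j"
  shows "concat (map fst (take p t)) \<noteq> [] \<longleftrightarrow>
    length ((\<eta> ^^ j) [a]) \<le> length (path_word \<eta> t)"
proof -
  define s r where "s = take p t" and "r = drop p t"
  have t: "t = s @ r" and len: "length s = p" "length r = j"
    using assms(3) by (auto simp: s_def r_def)
  have adm: "adm_path \<eta> a s" "adm_path \<eta> (path_end a s) r"
    using assms(2) by (auto simp: t adm_path_append)
  have pre: "prefix (path_word \<eta> s @ [path_end a s]) ((\<eta> ^^ p) [a])"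
    using prefix_path_word_end[OF adm(1)] len by simp
  show ?thesis
  proof (cases "path_word \<eta> s = []")
    case True
    \<comment> \<open>The end letter is now the first letter of \<open>(\<eta> ^^ p) [a]\<close>, so
      the remaining \<open>j\<close> steps start again from \<open>a\<close>.\<close>
    with pre assms(1) have "path_end a s = a" by (auto simp: prefix_def)
    moreover have "concat (map fst s) = []" using True path_word_eq_Nil_iff by blast
    ultimately show ?thesis
      using length_path_word_less[OF adm(2)] True
      by (simp add: t path_word_append len del: concat_eq_Nil_conv)
  next
    case False
    \<comment> \<open>A nonempty prefix of \<open>(\<eta> ^^ p) [a]\<close> starts with
      \<open>a\<close>, so the top steps alone already contribute
      \<open>(\<eta> ^^ j) [a]\<close>.\<close>
    then have "prefix [a] (path_word \<eta> s)"
      using pre assms(1) by (cases "path_word \<eta> s") (auto simp: prefix_def)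
    then have "length ((\<eta> ^^ j) [a]) \<le> length (path_word \<eta> t)"
      using length_funpow_mono_prefix[of "[a]" "path_word \<eta> s" j]
      by (simp add: t path_word_append len)
    with False show ?thesis by (simp add: path_word_eq_Nil_iff t len)
  qed
qed

section \<open>Action on right-infinite words\<close>

lemma stream_action_shift:
  "stream_action \<eta> (w @- u) = \<eta> w @- stream_action \<eta> u"
proof (induction w)
  case (Cons x w)
  have "stream_action \<eta> ((x # w) @- u) = \<eta> [x] @- stream_action \<eta> (w @- u)"
    by (simp add: stream_action_def flat_Stream morph_nonempty)
  with Cons show ?case using morph_append[of "[x]" w] by simp
qed (simp add: morph_Nil)

lemma funpow_stream_action_shift:
  "(stream_action \<eta> ^^ k) (w @- u) = (\<eta> ^^ k) w @- (stream_action \<eta> ^^ k) u"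
  by (induction k) (simp_all add: stream_action_shift)

lemma period_point_shift:
  assumes "(stream_action \<eta> ^^ p) u = u"
  shows "\<exists>v. u = (\<eta> ^^ (p * q)) [shd u] @- v"
proof -
  have "(stream_action \<eta> ^^ (p * q)) u = u"
    by (induction q) (simp_all add: funpow_add assms)
  moreover have "u = [shd u] @- stl u" by simp
  ultimately show ?thesis using funpow_stream_action_shift by metis
qed

end

lemma ex1_step_interval:
  fixes L :: "nat \<Rightarrow> nat"
  assumes "mono L" "L 0 \<le> n" "\<exists>q. n < L q"
  shows "\<exists>!q. L q \<le> n \<and> n < L (Suc q)"
proof -
  define Q where "Q = (LEAST q. n < L q)"
  have "n < L Q" unfolding Q_def using assms(3) by (rule LeastI_ex)
  then obtain q where "Q = Suc q" using assms(2) by (cases Q) auto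
  with \<open>n < L Q\<close> have "L q \<le> n \<and> n < L (Suc q)"
    using not_less_Least[of q "\<lambda>q. n < L q"] by (auto simp: Q_def)
  moreover have "r = q" if "L r \<le> n \<and> n < L (Suc r)" "L q \<le> n \<and> n < L (Suc q)" for r q
    using that monoD[OF assms(1), of "Suc r" q] monoD[OF assms(1), of "Suc q" r]
    by (cases r q rule: linorder_cases) auto
  ultimately show ?thesis by blast
qed

theorem theorem11:
  fixes \<eta> :: "('a::finite) list \<Rightarrow> 'a list"
    and a :: 'a and u :: "'a stream" and p n :: nat
  assumes "substitution \<eta>"
    and "growing \<eta> a"
    and "periodic_point \<eta> u"
    and "u !! 0 = a"
    and "is_period \<eta> u p"
    and "n \<ge> 1"
  shows "\<exists>!(k, s). p dvd k \<and> length s = k \<and>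
           admissible \<eta> a s \<and>
           concat (map (\<lambda>i. fst (s ! i)) (rev [k - p..<k])) \<noteq> [] \<and>
           stake n u = concat (map (\<lambda>i. (\<eta> ^^ i) (fst (s ! i))) (rev [0..<k]))"
proof -
  interpret nonerasing_morphism \<eta>
    using assms(1) by unfold_locales (auto simp: substitution_def word_morphism_def)
  have p: "p \<ge> 1" and per: "(stream_action \<eta> ^^ p) u = u"
    using assms(5) by (auto simp: is_period_def)
  have a: "shd u = a" using assms(4) by simp
  define L where "L q = length ((\<eta> ^^ (p * q)) [a])" for q
  have stake_u: "stake m u = take m ((\<eta> ^^ (p * q)) [a])" if "m \<le> L q" for m q
  proof -
    obtain v where "u = (\<eta> ^^ (p * q)) [a] @- v" using period_point_shift[OF per] a by blast
    with that show ?thesis by (metis L_def stake_shift diff_is_0_eq stake.simps(1) append_Nil2)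
  qed
  have pre: "prefix [a] ((\<eta> ^^ p) [a])"
  proof -
    obtain v where v: "u = (\<eta> ^^ (p * 1)) [a] @- v" using period_point_shift[OF per] a by blast
    have "(\<eta> ^^ p) [a] \<noteq> []" by simp
    then show ?thesis using v a by (cases "(\<eta> ^^ p) [a]") auto
  qed
  have "mono L"
    unfolding mono_iff_le_Suc
  proof
    fix q
    have "(\<eta> ^^ (p * Suc q)) [a] = (\<eta> ^^ (p * q)) ((\<eta> ^^ p) [a])"
      by (simp add: funpow_add add.commute[of p])
    then show "L q \<le> L (Suc q)"
      using length_funpow_mono_prefix[OF pre, of "p * q"] by (simp add: L_def)
  qed
  moreover have "L 0 \<le> n" using assms(6) by (simp add: L_def)
  moreover have "\<exists>q. n < L q"
  proof -
    obtain N where N: "\<And>k. k \<ge> N \<Longrightarrow> Suc n \<le> length ((\<eta> ^^ k) [a])"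
      using assms(2) unfolding growing_def filterlim_at_top eventually_sequentially by metis
    have "N \<le> p * N" using p by simp
    then have "n < L N" using N[of "p * N"] by (simp add: L_def)
    then show ?thesis ..
  qed
  ultimately have "\<exists>!q. L q \<le> n \<and> n < L (Suc q)" by (rule ex1_step_interval)
  then obtain q where q: "L q \<le> n" "n < L (Suc q)"
    and q_unique: "\<And>r. L r \<le> n \<Longrightarrow> n < L (Suc r) \<Longrightarrow> r = q"
    by (elim ex1E) blast
  define good where "good k s \<longleftrightarrow> p dvd k \<and> length s = k \<and> admissible \<eta> a s \<and>
      concat (map (\<lambda>i. fst (s ! i)) (rev [k - p..<k])) \<noteq> [] \<and>
      stake n u = concat (map (\<lambda>i. (\<eta> ^^ i) (fst (s ! i))) (rev [0..<k]))" for k s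
  have good_iff: "good k s \<longleftrightarrow> k = p * Suc q \<and> length s = k \<and> adm_path \<eta> a (rev s) \<and>
      length (path_word \<eta> (rev s)) = n" for k s
  \<comment> \<open>Outside this case both sides fail: \<open>p dvd k\<close> and a nonempty
    \<open>s\<close> force \<open>k\<close> to be a positive multiple of \<open>p\<close>. Writing
    \<open>k = p * Suc r\<close> makes \<open>k - p\<close> equal to \<open>p * r\<close>.\<close>
  proof (cases "length s = k \<and> adm_path \<eta> a (rev s) \<and> (\<exists>r. k = p * Suc r)")
    case True
    then obtain r where k: "k = p * Suc r" "length s = k" and adm: "adm_path \<eta> a (rev s)" by auto
    have top: "concat (map (\<lambda>i. fst (s ! i)) (rev [k - p..<k])) \<noteq> [] \<longleftrightarrow>
        L r \<le> length (path_word \<eta> (rev s))"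
      using top_nonempty_iff[OF pre adm, of "p * r"] concat_top_eq_take_rev[of p s] k
      by (simp add: L_def)
    have less: "length (path_word \<eta> (rev s)) < L (Suc r)"
      using length_path_word_less[OF adm] k by (simp add: L_def)
    \<comment> \<open>Both words are prefixes of \<open>(\<eta> ^^ k) [a]\<close>, so equality in
      (ii) reduces to equality of lengths.\<close>
    have word: "stake n u = path_word \<eta> (rev s) \<longleftrightarrow> length (path_word \<eta> (rev s)) = n"
    proof
      assume "length (path_word \<eta> (rev s)) = n"
      then show "stake n u = path_word \<eta> (rev s)"
        using path_word_eq_take[OF adm] stake_u[of n "Suc r"] less k by simp
    qed (metis length_stake)
    have "s \<noteq> []" using k p by auto
    then have "good k s \<longleftrightarrow> L r \<le> n \<and> length (path_word \<eta> (rev s)) = n"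
      using k adm top word concat_powers_eq_path_word[of \<eta> s]
      by (auto simp: good_def admissible_iff_adm_path)
    \<comment> \<open>The upper bound \<open>n < L (Suc r)\<close> comes from \<open>less\<close>,
      so only the interval of \<open>q\<close> remains.\<close>
    also have "\<dots> \<longleftrightarrow> r = q \<and> length (path_word \<eta> (rev s)) = n"
      using q q_unique[of r] less by auto
    finally show ?thesis using k adm p by auto
  next
    case False
    moreover have "\<exists>r. k = p * Suc r" if "p dvd k" "length s = k" "s \<noteq> []"
      using that by (metis dvd_def length_0_conv mult_0_right not0_implies_Suc)
    ultimately show ?thesis by (auto simp: good_def admissible_iff_adm_path)
  qed
  obtain t where t: "adm_path \<eta> a t" "length t = p * Suc q" "length (path_word \<eta> t) = n"
    using adm_path_exists q(2) unfolding L_def by blast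
  have "\<exists>!(k, s). good k s"
  proof (rule ex1I[of _ "(p * Suc q, rev t)"])
    show "case (p * Suc q, rev t) of (k, s) \<Rightarrow> good k s" using t by (simp add: good_iff)
  next
    fix y assume y: "case y of (k, s) \<Rightarrow> good k s"
    obtain k s where ks: "y = (k, s)" by (cases y)
    with y have "k = p * Suc q" "length s = k" "adm_path \<eta> a (rev s)"
      "length (path_word \<eta> (rev s)) = n"
      by (simp_all add: good_iff)
    then have "rev s = t" using adm_path_unique t by simp
    with ks \<open>k = p * Suc q\<close> show "y = (p * Suc q, rev t)" by auto
  qed
  then show ?thesis unfolding good_def .
qed

end
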